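(* The converse of the implication "if $H(A)$ is $\sigma$-compact, then $\mathbb{R}\setminus A$ is countable and nowhere dense in $H(A)$" fails: there exists a subset $A \subseteq \mathbb{R}$ such that $\mathbb{R} \setminus A$ is countable and nowhere dense in $H(A)$, but $H(A)$ is not $\sigma$-compact.
   Context: For $A \subseteq \mathbb{R}$, the Hattori space $H(A)$ is the set $\mathbb{R}$ with the topology $\tau(A)$ in which a point $x \in A$ has open neighbourhood basis $\{(x-\epsilon, x+\epsilon) : \epsilon > 0\}$ and a point $x \in \mathbb{R}\setminus A$ has open neighbourhood basis $\{[x, x+\epsilon) : \epsilon > 0\}$. A space is $\sigma$-compact if it is a union of countably many compact subsets. *)

theory Defs
  imports "HOL-Analysis.Analysis"
begin

definition hattori_nbhd :: "real set \<Rightarrow> real \<Rightarrow> real \<Rightarrow> real set" where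
  "hattori_nbhd A x \<epsilon> = (if x \<in> A then {x - \<epsilon><..<x + \<epsilon>} else {x..<x + \<epsilon>})"

text \<open>The topology whose open neighbourhood basis at each point \<open>x\<close> is
  \<open>{hattori_nbhd A x \<epsilon> | \<epsilon>. \<epsilon> > 0}\<close>; the lemmas below confirm that these sets are
  open and form a basis at \<open>x\<close>, and that the carrier is the whole real line.\<close>

definition hattori :: "real set \<Rightarrow> real topology" where
  "hattori A = topology (\<lambda>U. \<forall>x\<in>U. \<exists>\<epsilon>>0. hattori_nbhd A x \<epsilon> \<subseteq> U)"

definition nowhere_dense_in :: "'a topology \<Rightarrow> 'a set \<Rightarrow> bool" where
  "nowhere_dense_in X S \<longleftrightarrow> S \<subseteq> topspace X \<and> X interior_of (X closure_of S) = {}"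

definition sigma_compact_space :: "'a topology \<Rightarrow> bool" where
  "sigma_compact_space X \<longleftrightarrow>
     (\<exists>\<K>. countable \<K> \<and> (\<forall>K\<in>\<K>. compactin X K) \<and> \<Union>\<K> = topspace X)"

lemma hattori_nbhd_mono: "\<delta> \<le> \<epsilon> \<Longrightarrow> hattori_nbhd A x \<delta> \<subseteq> hattori_nbhd A x \<epsilon>"
  by (auto simp: hattori_nbhd_def)

lemma openin_hattori:
  "openin (hattori A) U \<longleftrightarrow> (\<forall>x\<in>U. \<exists>\<epsilon>>0. hattori_nbhd A x \<epsilon> \<subseteq> U)"
proof -
  have "istopology (\<lambda>U. \<forall>x\<in>U. \<exists>\<epsilon>>0. hattori_nbhd A x \<epsilon> \<subseteq> U)"
    unfolding istopology_def
  proof (intro conjI allI impI ballI)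
    fix S T x
    assume S: "\<forall>x\<in>S. \<exists>\<epsilon>>0. hattori_nbhd A x \<epsilon> \<subseteq> S"
      and T: "\<forall>x\<in>T. \<exists>\<epsilon>>0. hattori_nbhd A x \<epsilon> \<subseteq> T" and x: "x \<in> S \<inter> T"
    obtain d e where "d > 0" "hattori_nbhd A x d \<subseteq> S" "e > 0" "hattori_nbhd A x e \<subseteq> T"
      using S T x by blast
    then have "min d e > 0 \<and> hattori_nbhd A x (min d e) \<subseteq> S \<inter> T"
      using hattori_nbhd_mono[of "min d e" d A x] hattori_nbhd_mono[of "min d e" e A x] by auto
    then show "\<exists>\<epsilon>>0. hattori_nbhd A x \<epsilon> \<subseteq> S \<inter> T" by blast
  next
    fix \<K> x
    assume K: "\<forall>S\<in>\<K>. \<forall>x\<in>S. \<exists>\<epsilon>>0. hattori_nbhd A x \<epsilon> \<subseteq> S" and x: "x \<in> \<Union>\<K>"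
    then show "\<exists>\<epsilon>>0. hattori_nbhd A x \<epsilon> \<subseteq> \<Union>\<K>"
      by (meson UnionE Union_upper order_trans)
  qed
  then show ?thesis by (simp add: hattori_def topology_inverse')
qed

lemma topspace_hattori [simp]: "topspace (hattori A) = UNIV"
proof -
  have "openin (hattori A) UNIV"
    unfolding openin_hattori using zero_less_one by blast
  then show ?thesis
    using openin_subset by blast
qed

lemma mem_hattori_nbhd: "\<epsilon> > 0 \<Longrightarrow> x \<in> hattori_nbhd A x \<epsilon>"
  by (simp add: hattori_nbhd_def)

lemma openin_hattori_nbhd: "openin (hattori A) (hattori_nbhd A x \<epsilon>)"
  unfolding openin_hattori
proof
  fix y assume y: "y \<in> hattori_nbhd A x \<epsilon>"
  define d where "d = (if y = x then \<epsilon> else min (x + \<epsilon> - y) (if x \<in> A then y - (x - \<epsilon>) else y - x))"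
  have "d > 0" and "hattori_nbhd A y d \<subseteq> hattori_nbhd A x \<epsilon>"
    using y by (auto simp: hattori_nbhd_def d_def split: if_splits)
  then show "\<exists>\<delta>>0. hattori_nbhd A y \<delta> \<subseteq> hattori_nbhd A x \<epsilon>" by blast
qed

end

theory Submission
  imports Defs
begin

text \<open>Let \<open>B\<close> be the set of the numbers \<open>- (\<Sum>i\<in>F. 4\<^sup>-\<^sup>i)\<close>, \<open>F\<close> finite, and
  let \<open>A\<close> be the complement of \<open>B\<close>. The set \<open>B\<close> is countable and its Euclidean closure \<open>C\<close>
  is a null set, so \<open>B\<close> is nowhere dense. Every point of \<open>B\<close> is a limit of points of \<open>B\<close>
  from the left, whereas a compact subset of \<open>H(A)\<close> leaves a gap to the left of each of its
  points outside \<open>A\<close>. If \<open>H(A)\<close> were a countable union of compact sets, which are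
  Euclidean closed, then by Baire one of them would contain a nonempty relatively open part of
  \<open>C\<close>, hence a point of \<open>B\<close> together with points of \<open>B\<close> converging to it from
  the left.\<close>

lemma openin_hattori_if_open:
  assumes "open U"
  shows "openin (hattori A) U"
  unfolding openin_hattori
proof
  fix x assume "x \<in> U"
  then obtain e where "e > 0" "ball x e \<subseteq> U"
    using assms open_contains_ball by blast
  then have "hattori_nbhd A x e \<subseteq> U"
    by (auto simp: hattori_nbhd_def subset_iff dist_real_def)
  then show "\<exists>e>0. hattori_nbhd A x e \<subseteq> U"
    using \<open>e > 0\<close> by blast
qed

text \<open>Refining a topology can only shrink closures.\<close>

lemma closure_of_hattori_subset: "hattori A closure_of S \<subseteq> closure S"
proof (rule closure_of_minimal)
  show "closedin (hattori A) (closure S)"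
    using openin_hattori_if_open[of "- closure S" A] by (auto simp: closedin_def Compl_eq_Diff_UNIV)
qed (rule closure_subset)

lemma openin_hattori_contains_interval:
  assumes "openin (hattori A) U" "x \<in> U"
  obtains e where "e > 0" "{x..<x + e} \<subseteq> U"
proof -
  obtain e where "e > 0" "hattori_nbhd A x e \<subseteq> U"
    using assms unfolding openin_hattori by blast
  moreover have "{x..<x + e} \<subseteq> hattori_nbhd A x e"
    using \<open>e > 0\<close> by (auto simp: hattori_nbhd_def)
  ultimately show thesis
    using that by blast
qed

lemma compact_if_compactin_hattori:
  assumes "compactin (hattori A) K"
  shows "compact K"
proof -
  have "continuous_map (hattori A) euclidean id"
    by (simp add: continuous_map_def openin_hattori_if_open)
  from image_compactin[OF assms this] show ?thesis by simp
qed

text \<open>Since \<open>b \<notin> A\<close>, the ray \<open>{b..}\<close> is open, so the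
  increasing open sets \<open>U n\<close> cover \<open>K\<close> while each omits an interval ending
  at \<open>b\<close>. By compactness a single \<open>U m\<close> contains \<open>K\<close>.\<close>

lemma compactin_hattori_left_gap:
  assumes K: "compactin (hattori A) K" and b: "b \<notin> A"
  obtains e where "e > 0" "K \<inter> {b - e<..<b} = {}"
proof -
  define U where "U n = {..<b - inverse (real (Suc n))} \<union> {b..}" for n
  have "openin (hattori A) (U n)" for n
  proof -
    have "openin (hattori A) {b..}"
      unfolding openin_hattori
    proof
      fix x assume "x \<in> {b..}"
      \<comment> \<open>At \<open>b\<close> itself any radius works; for \<open>x > b\<close> the
        radius \<open>x - b\<close> stops a two-sided neighbourhood at \<open>b\<close>.\<close>
      then have "hattori_nbhd A x (if x = b then 1 else x - b) \<subseteq> {b..}"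
        using b by (auto simp: hattori_nbhd_def)
      moreover have "(if x = b then 1 else x - b) > 0"
        using \<open>x \<in> {b..}\<close> by auto
      ultimately show "\<exists>e>0. hattori_nbhd A x e \<subseteq> {b..}" by blast
    qed
    then show ?thesis
      unfolding U_def by (rule openin_Un[OF openin_hattori_if_open[OF open_lessThan]])
  qed
  then have "\<forall>V\<in>range U. openin (hattori A) V"
    by (simp only: ball_simps simp_thms)
  moreover have "K \<subseteq> \<Union> (range U)"
  proof
    fix x assume "x \<in> K"
    show "x \<in> \<Union> (range U)"
    proof (cases "x < b")
      case True
      then obtain n where "inverse (real (Suc n)) < b - x"
        using reals_Archimedean[of "b - x"] by auto
      then have "x \<in> U n" by (auto simp: U_def)
      then show ?thesis by blast
    qed (auto simp: U_def)
  qed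
  ultimately have "\<exists>\<F>. finite \<F> \<and> \<F> \<subseteq> range U \<and> K \<subseteq> \<Union>\<F>"
    using K unfolding compactin_def by blast
  then obtain \<F> where \<F>: "finite \<F>" "\<F> \<subseteq> range U" "K \<subseteq> \<Union>\<F>"
    by blast
  with finite_subset_image[OF \<F>(1,2)] obtain N where N: "finite N" "K \<subseteq> \<Union> (U ` N)"
    by blast
  \<comment> \<open>Inserting \<open>0\<close> keeps the maximum meaningful when \<open>N\<close> is
    empty.\<close>
  define m where "m = Max (insert 0 N)"
  have "U n \<subseteq> U m" if "n \<in> N" for n
  proof -
    have "n \<le> m" unfolding m_def using N that by auto
    then have "inverse (real (Suc m)) \<le> inverse (real (Suc n))"
      by (intro le_imp_inverse_le) auto
    then have "{..<b - inverse (real (Suc n))} \<subseteq> {..<b - inverse (real (Suc m))}"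
      unfolding lessThan_subset_iff by (rule diff_left_mono)
    then show ?thesis unfolding U_def by (rule Un_mono[OF _ order_refl])
  qed
  with N have "K \<subseteq> U m" by blast
  then have "K \<inter> {b - inverse (real (Suc m))<..<b} = {}"
    by (auto simp: U_def)
  then show thesis
    using that[of "inverse (real (Suc m))"] by simp
qed

lemma not_sigma_compact_hattori:
  assumes "B \<noteq> {}" and BA: "B \<inter> A = {}"
    and left: "\<And>b e. b \<in> B \<Longrightarrow> e > 0 \<Longrightarrow> B \<inter> {b - e<..<b} \<noteq> {}"
  shows "\<not> sigma_compact_space (hattori A)"
proof
  assume "sigma_compact_space (hattori A)"
  then obtain \<K> where \<K>: "countable \<K>" "\<And>K. K \<in> \<K> \<Longrightarrow> compactin (hattori A) K" "\<Union>\<K> = UNIV"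
    by (auto simp: sigma_compact_space_def)
  define C where "C = closure B"
  \<comment> \<open>Otherwise all sets \<open>C - K\<close> are relatively open and dense in
    \<open>C\<close>, and by Baire so is their intersection, which is empty.\<close>
  have "\<exists>K\<in>\<K>. \<not> C \<subseteq> closure (C - K)"
  proof (rule ccontr)
    assume *: "\<not> ?thesis"
    have "C \<subseteq> closure (\<Inter> ((\<lambda>K. C - K) ` \<K>))"
    proof (rule Baire)
      fix T assume "T \<in> (\<lambda>K. C - K) ` \<K>"
      then obtain K where K: "K \<in> \<K>" "T = C - K" by blast
      then have "closed K"
        using \<K>(2) compact_if_compactin_hattori compact_imp_closed by blast
      then have "openin (top_of_set C) T"
        unfolding openin_open using K by (intro exI[of _ "- K"]) auto
      then show "openin (top_of_set C) T \<and> C \<subseteq> closure T"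
        using * K by blast
    qed (use \<K> in \<open>auto simp: C_def\<close>)
    moreover have "\<Inter> ((\<lambda>K. C - K) ` \<K>) = {}"
      using \<K>(3) by auto
    ultimately show False
      using \<open>B \<noteq> {}\<close> closure_subset[of B] by (auto simp: C_def)
  qed
  then obtain K x where K: "K \<in> \<K>" and x: "x \<in> C" "x \<notin> closure (C - K)"
    by blast
  \<comment> \<open>Within \<open>V\<close> the set \<open>C\<close> lies in \<open>K\<close>; as
    \<open>V\<close> meets \<open>C\<close>, it contains a point of \<open>B\<close>.\<close>
  define V where "V = - closure (C - K)"
  have V: "open V" "x \<in> V" "V \<inter> B \<subseteq> K"
    using x closure_subset[of "C - K"] closure_subset[of B] by (auto simp: V_def C_def)
  then obtain b where b: "b \<in> B" "b \<in> V"
    using x(1) unfolding C_def closure_iff_nhds_not_empty by blast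
  obtain d where d: "d > 0" "K \<inter> {b - d<..<b} = {}"
    using compactin_hattori_left_gap[OF \<K>(2)[OF K]] BA b by blast
  obtain e where e: "e > 0" "ball b e \<subseteq> V"
    using V b open_contains_ball by blast
  obtain c where "c \<in> B" "b - min d e < c" "c < b"
    using left[OF b(1), of "min d e"] d e by auto
  then have "c \<in> K \<inter> {b - d<..<b}"
    using V e by (auto simp: dist_real_def subset_iff)
  then show False
    using d by blast
qed

text \<open>A ratio below 1/2 makes the set of all such sums null.\<close>

definition quarter_sum :: "nat set \<Rightarrow> real" where
  "quarter_sum F = (\<Sum>i\<in>F. (1/4) ^ i)"

lemma quarter_sum_tail:
  assumes "finite F" "F \<subseteq> {n..}"
  shows "0 \<le> quarter_sum F" "quarter_sum F \<le> 2 * (1/4) ^ n"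
proof -
  show "0 \<le> quarter_sum F"
    unfolding quarter_sum_def by (intro sum_nonneg) auto
  obtain k where "F \<subseteq> {..<k}"
    using assms(1) finite_nat_bounded by blast
  then have "quarter_sum F \<le> (\<Sum>i=n..<n+k. (1/4) ^ i)"
    unfolding quarter_sum_def using assms by (intro sum_mono2) (auto simp: subset_iff intro: trans_less_add2)
  \<comment> \<open>The subtracted term strengthens the bound enough for the induction to go
    through.\<close>
  also have "\<dots> \<le> 2 * (1/4) ^ n - 2 * (1/4) ^ (n + k)"
  proof (induction k)
    case (Suc k)
    define q :: real where "q = (1/4) ^ (n + k)"
    have "0 \<le> q" by (simp add: q_def)
    moreover have "(1/4) ^ (n + Suc k) = q / 4" by (simp add: q_def)
    moreover have "(\<Sum>i=n..<n + Suc k. (1/4) ^ i) = (\<Sum>i=n..<n + k. (1/4) ^ i) + q"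
      by (simp add: q_def)
    ultimately show ?case using Suc unfolding q_def[symmetric] by linarith
  qed simp
  also have "\<dots> \<le> 2 * (1/4) ^ n"
    by simp
  finally show "quarter_sum F \<le> 2 * (1/4) ^ n" .
qed

text \<open>The sign turns approximation from the right into approximation from the left.\<close>

abbreviation neg_quarter_sums :: "real set" where
  "neg_quarter_sums \<equiv> (\<lambda>F. - quarter_sum F) ` Collect finite"

lemma neg_quarter_sums_left_limit:
  assumes "b \<in> neg_quarter_sums" "e > 0"
  shows "neg_quarter_sums \<inter> {b - e<..<b} \<noteq> {}"
proof -
  obtain F where F: "finite F" "b = - quarter_sum F"
    using assms by auto
  obtain k where k: "F \<subseteq> {..<k}"
    using F finite_nat_bounded by blast
  obtain n where n: "(1/4::real) ^ n < e"
    using real_arch_pow_inv[of e "1/4"] assms by auto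
  \<comment> \<open>\<open>m \<ge> k\<close> makes the index new to \<open>F\<close>, and
    \<open>m \<ge> n\<close> makes the shift smaller than \<open>e\<close>.\<close>
  define m where "m = max k n"
  have "(1/4::real) ^ m \<le> (1/4) ^ n"
    unfolding m_def by (intro power_decreasing) auto
  with n have "(1/4) ^ m < e" by linarith
  moreover have "m \<notin> F"
    using k by (auto simp: m_def)
  then have "- quarter_sum (insert m F) = b - (1/4) ^ m"
    using F by (simp add: quarter_sum_def)
  moreover have "- quarter_sum (insert m F) \<in> neg_quarter_sums"
    using F by blast
  ultimately have "b - (1/4) ^ m \<in> neg_quarter_sums \<inter> {b - e<..<b}"
    by simp
  then show ?thesis by blast
qed

text \<open>Splitting \<open>F\<close> at \<open>n\<close> leaves finitely many heads
  \<open>G\<close> and a tail of at most \<open>2 * (1/4) ^ n\<close>. The finite union of closed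
  intervals is closed.\<close>

lemma closure_neg_quarter_sums_subset:
  "closure neg_quarter_sums
    \<subseteq> (\<Union>G\<in>Pow {..<n}. {- quarter_sum G - 2 * (1/4) ^ n..- quarter_sum G})"
proof (rule closure_minimal)
  show "neg_quarter_sums
    \<subseteq> (\<Union>G\<in>Pow {..<n}. {- quarter_sum G - 2 * (1/4) ^ n..- quarter_sum G})"
  proof
    fix x assume "x \<in> neg_quarter_sums"
    then obtain F where F: "finite F" "x = - quarter_sum F" by auto
    have "quarter_sum F = quarter_sum (F \<inter> {..<n}) + quarter_sum (F - {..<n})"
      unfolding quarter_sum_def using F(1) by (simp add: sum.Int_Diff)
    moreover have "F - {..<n} \<subseteq> {n..}" "finite (F - {..<n})"
      using F by auto
    note quarter_sum_tail[OF this(2,1)]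
    ultimately have "x \<in> {- quarter_sum (F \<inter> {..<n}) - 2 * (1/4) ^ n..- quarter_sum (F \<inter> {..<n})}"
      using F by auto
    then show "x \<in> (\<Union>G\<in>Pow {..<n}. {- quarter_sum G - 2 * (1/4) ^ n..- quarter_sum G})"
      by (rule UN_I[rotated]) simp
  qed
qed (intro closed_UN ballI closed_atLeastAtMost finite_Pow_iff[THEN iffD2] finite_lessThan)

text \<open>The closure is covered by \<open>2 ^ n\<close> intervals of total length
  \<open>2 * (1/2) ^ n\<close>, which is below \<open>e\<close> for large \<open>n\<close>.\<close>

lemma interval_not_subset_closure_neg_quarter_sums:
  assumes "e > 0"
  shows "\<not> {x..<x + e} \<subseteq> closure neg_quarter_sums"
proof
  assume sub: "{x..<x + e} \<subseteq> closure neg_quarter_sums"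
  obtain n where n: "(1/2::real) ^ n < e / 2"
    using real_arch_pow_inv[of "e / 2" "1/2"] assms by auto
  define J where "J G = {- quarter_sum G - 2 * (1/4) ^ n..- quarter_sum G}" for G
  have "ennreal e = emeasure lborel {x..<x + e}"
    using assms by simp
  also have "\<dots> \<le> emeasure lborel (\<Union> (J ` Pow {..<n}))"
    using sub closure_neg_quarter_sums_subset[of n]
    by (intro emeasure_mono) (auto simp: J_def)
  also have "\<dots> \<le> (\<Sum>G\<in>Pow {..<n}. emeasure lborel (J G))"
    by (intro emeasure_subadditive_finite) (auto simp: J_def)
  also have "\<dots> = (\<Sum>G\<in>Pow {..<n}. ennreal (2 * (1/4) ^ n))"
    by (intro sum.cong) (auto simp: J_def)
  also have "\<dots> = ennreal (2 ^ n * (2 * (1/4) ^ n))"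
    by (subst sum_ennreal) (auto simp: card_Pow)
  also have "2 ^ n * (2 * (1/4) ^ n) = 2 * (1/2::real) ^ n"
    by (simp add: power_divide flip: power_mult_distrib)
      (simp add: field_simps flip: power_mult_distrib)
  finally show False
    using n assms by simp
qed

theorem corollary2p4:
  shows "\<exists>A :: real set.
           countable (UNIV - A) \<and> nowhere_dense_in (hattori A) (UNIV - A) \<and>
           \<not> sigma_compact_space (hattori A)"
proof (intro exI conjI)
  let ?A = "- neg_quarter_sums"
  have eq: "UNIV - ?A = neg_quarter_sums" by blast
  show "countable (UNIV - ?A)"
    unfolding eq by (intro countable_image countable_Collect_finite)
  show "nowhere_dense_in (hattori ?A) (UNIV - ?A)"
    unfolding nowhere_dense_in_def eq
  proof (intro conjI equals0I)
    fix x assume "x \<in> hattori ?A interior_of (hattori ?A closure_of neg_quarter_sums)"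
    \<comment> \<open>Every Hattori neighbourhood contains a right half-open interval, so both kinds
      of points are treated alike.\<close>
    then obtain e where "e > 0" "{x..<x + e} \<subseteq> hattori ?A closure_of neg_quarter_sums"
      by (meson openin_hattori_contains_interval openin_interior_of interior_of_subset order_trans)
    then show False
      using closure_of_hattori_subset interval_not_subset_closure_neg_quarter_sums
      by (meson order_trans)
  qed simp
  show "\<not> sigma_compact_space (hattori ?A)"
    by (rule not_sigma_compact_hattori[OF _ _ neg_quarter_sums_left_limit]) auto
qed

end
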